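(* The class of Type $2$ digraphs is determined by the complementarity spectrum (DCS): for every $n$, if $D$ and $H$ are Type $2$ digraphs, both with $n$ vertices, and $\Pi(D)=\Pi(H)$, then $D$ and $H$ are isomorphic.
   Context: Digraphs are finite and simple (no loops, no multiple arcs; opposite arcs are allowed). The adjacency matrix $A(D)=(a_{ij})$ of a digraph $D$ has $a_{ij}=1$ if $(i,j)$ is an arc and $a_{ij}=0$ otherwise. A real number $\lambda$ is a complementarity eigenvalue of a real $n\times n$ matrix $A$ if there is a nonzero vector $x\in\mathbb{R}^n$ with $x\ge 0$ (coordinatewise), $Ax\ge\lambda x$ and $\langle x,Ax-\lambda x\rangle=0$. The complementarity spectrum $\Pi(D)$ is the set (not multiset) of complementarity eigenvalues of $A(D)$; it does not depend on the vertex labelling. For integers $r,s\ge 2$, $\infty(r,s)$ is the digraph on $n=r+s-1$ vertices obtained from the directed cycles $\vec C_r$ (vertices $1,\dots,r$, arcs $(k,k+1)$ and $(r,1)$) and $\vec C_s$ (vertices $1',\dots,s'$, arcs $(k',(k+1)')$ and $(s',1')$) by identifying $1$ with $1'$. The digraph $D_2(r,s)$ is obtained from $\infty(r,s)$ by adding the two arcs $(r,2')$ and $(s',2)$. A Type $2$ digraph is a digraph isomorphic to some $D_2(r,s)$. A class of digraphs is DCS if any two digraphs of the class having the same number of vertices and the same complementarity spectrum are isomorphic. *)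

theory Defs
  imports "Graph_Theory.Graph_Theory" "Jordan_Normal_Form.Matrix" "HOL.Real"
begin

definition complementarity_eigenvalue :: "real mat \<Rightarrow> real \<Rightarrow> bool" where
  "complementarity_eigenvalue A lam \<longleftrightarrow>
     (\<exists>n x. A \<in> carrier_mat n n \<and> x \<in> carrier_vec n \<and> x \<noteq> 0\<^sub>v n \<and> 0\<^sub>v n \<le> x \<and>
            lam \<cdot>\<^sub>v x \<le> A *\<^sub>v x \<and> x \<bullet> (A *\<^sub>v x - lam \<cdot>\<^sub>v x) = 0)"

text \<open>A labelling of the vertices is a repetition-free list \<open>vs\<close> of them; the entry at
  position \<open>i\<close> is the vertex with label \<open>i\<close>.\<close>

definition adjacency_matrix :: "('a, 'b) pre_digraph \<Rightarrow> 'a list \<Rightarrow> real mat" where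
  "adjacency_matrix G vs =
     mat (length vs) (length vs) (\<lambda>(i, j). if vs ! i \<rightarrow>\<^bsub>G\<^esub> vs ! j then 1 else 0)"

text \<open>The labelling is irrelevant: see \<open>complementarity_spectrum_labelling\<close> below, which says
  that every single labelling already yields the whole set.\<close>

definition complementarity_spectrum :: "('a, 'b) pre_digraph \<Rightarrow> real set" where
  "complementarity_spectrum G =
     {lam. \<exists>vs. distinct vs \<and> set vs = verts G \<and>
                complementarity_eigenvalue (adjacency_matrix G vs) lam}"

definition dicycle_arcs :: "nat \<Rightarrow> (nat \<times> nat) set" where
  "dicycle_arcs r = {(k, k + 1) | k. 1 \<le> k \<and> k < r} \<union> {(r, 1)}"

text \<open>The vertices of the first cycle are \<open>1, \<dots>, r\<close>. The vertex \<open>k'\<close> of the second cycle is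
  encoded as \<open>primed r k\<close>, which realises the identification of \<open>1'\<close> with \<open>1\<close>.\<close>

definition primed :: "nat \<Rightarrow> nat \<Rightarrow> nat" where
  "primed r k = (if k = 1 then 1 else r + k - 1)"

definition infty_digraph :: "nat \<Rightarrow> nat \<Rightarrow> nat pair_pre_digraph" where
  "infty_digraph r s =
     \<lparr> pverts = {1..r} \<union> primed r ` {1..s},
       parcs = dicycle_arcs r \<union> map_prod (primed r) (primed r) ` dicycle_arcs s \<rparr>"

definition D2 :: "nat \<Rightarrow> nat \<Rightarrow> nat pair_pre_digraph" where
  "D2 r s =
     \<lparr> pverts = pverts (infty_digraph r s),
       parcs = parcs (infty_digraph r s) \<union> {(r, primed r 2), (primed r s, 2)} \<rparr>"

definition type2_digraph :: "('a, 'b) pre_digraph \<Rightarrow> bool" where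
  "type2_digraph G \<longleftrightarrow> (\<exists>r s. 2 \<le> r \<and> 2 \<le> s \<and> digraph_iso (with_proj (D2 r s)) G)"


lemma pverts_D2:
  assumes "2 \<le> r" "2 \<le> s"
  shows "pverts (D2 r s) = {1..r + s - 1}"
proof -
  have "primed r ` {1..s} = {1} \<union> (\<lambda>k. r + k - 1) ` {2..s}"
  proof -
    have "{1..s} = {1} \<union> {2..s}" using assms by auto
    then show ?thesis by (auto simp: primed_def image_iff)
  qed
  moreover have "(\<lambda>k. r + k - 1) ` {2..s} = {r + 1..r + s - 1}"
  proof (intro equalityI subsetI)
    fix x assume "x \<in> {r + 1..r + s - 1}"
    then show "x \<in> (\<lambda>k. r + k - 1) ` {2..s}"
      by (intro image_eqI[of _ _ "x - r + 1"]) auto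
  qed auto
  ultimately show ?thesis
    using assms by (auto simp: D2_def infty_digraph_def)
qed

lemma card_D2: "2 \<le> r \<Longrightarrow> 2 \<le> s \<Longrightarrow> card (pverts (D2 r s)) = r + s - 1"
  by (simp add: pverts_D2)

lemma pair_digraph_D2:
  assumes "2 \<le> r" "2 \<le> s"
  shows "pair_digraph (D2 r s)"
proof -
  have cyc: "fst e \<in> {1..m} \<and> snd e \<in> {1..m} \<and> fst e \<noteq> snd e"
    if "e \<in> dicycle_arcs m" "2 \<le> m" for e m
    using that by (auto simp: dicycle_arcs_def)
  have prim: "primed r k \<in> {1..r + s - 1}" if "k \<in> {1..s}" for k
    using that assms by (auto simp: primed_def)
  have inj: "primed r k = primed r l \<longleftrightarrow> k = l" if "k \<in> {1..s}" "l \<in> {1..s}" for k l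
    using that assms by (auto simp: primed_def)
  have arcs: "fst e \<in> pverts (D2 r s) \<and> snd e \<in> pverts (D2 r s) \<and> fst e \<noteq> snd e"
    if "e \<in> parcs (D2 r s)" for e
  proof -
    have "primed r 2 = r + 1" "primed r s = r + s - 1"
      using assms by (auto simp: primed_def)
    then have "e \<in> dicycle_arcs r \<or> e \<in> map_prod (primed r) (primed r) ` dicycle_arcs s \<or>
               e = (r, r + 1) \<or> e = (r + s - 1, 2)"
      using that by (simp add: D2_def infty_digraph_def) blast
    then show ?thesis
    proof (elim disjE imageE)
      assume "e \<in> dicycle_arcs r"
      from cyc[OF this assms(1)] assms show ?thesis by (auto simp: pverts_D2)
    next
      fix e' assume "e = map_prod (primed r) (primed r) e'" "e' \<in> dicycle_arcs s"
      with cyc[of e' s] assms(2) prim[of "fst e'"] prim[of "snd e'"] inj[of "fst e'" "snd e'"]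
      show ?thesis by (simp add: pverts_D2[OF assms])
    qed (use assms in \<open>auto simp: pverts_D2\<close>)
  qed
  have sub: "parcs (D2 r s) \<subseteq> pverts (D2 r s) \<times> pverts (D2 r s)"
    using arcs by (auto simp: mem_Times_iff)
  have fin: "finite (pverts (D2 r s))" by (simp add: pverts_D2[OF assms])
  have "finite (parcs (D2 r s))" by (rule finite_subset[OF sub]) (simp add: fin)
  with fin arcs show ?thesis by unfold_locales simp_all
qed

lemma complementarity_eigenvalue_adjacency_matrix:
  assumes vs: "distinct vs" "set vs = verts G"
  shows "complementarity_eigenvalue (adjacency_matrix G vs) lam \<longleftrightarrow>
    (\<exists>x. (\<exists>v\<in>verts G. x v \<noteq> 0) \<and> (\<forall>v\<in>verts G. 0 \<le> x v) \<and>
         (\<forall>v\<in>verts G. lam * x v \<le> (\<Sum>w\<in>verts G. if v \<rightarrow>\<^bsub>G\<^esub> w then x w else 0)) \<and>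
         (\<Sum>v\<in>verts G. x v * ((\<Sum>w\<in>verts G. if v \<rightarrow>\<^bsub>G\<^esub> w then x w else 0) - lam * x v)) = 0)"
    (is "?L \<longleftrightarrow> (\<exists>x. ?R x)")
proof -
  define n where "n = length vs"
  have bij: "bij_betw ((!) vs) {0..<n} (verts G)"
    using bij_betw_nth[OF vs(1) _ vs(2)[symmetric]] by (simp add: n_def lessThan_atLeast0)
  have ball: "(\<forall>v\<in>verts G. P v) \<longleftrightarrow> (\<forall>i<n. P (vs ! i))" for P
    using bij_betw_imp_surj_on[OF bij] by (metis atLeastLessThan_iff image_iff zero_le)
  have bex: "(\<exists>v\<in>verts G. P v) \<longleftrightarrow> (\<exists>i<n. P (vs ! i))" for P
    using ball[of "\<lambda>v. \<not> P v"] by blast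
  have sum: "(\<Sum>v\<in>verts G. h v) = (\<Sum>i = 0..<n. h (vs ! i))" for h :: "_ \<Rightarrow> real"
    using sum.reindex_bij_betw[OF bij, of h] by simp
  have carr: "adjacency_matrix G vs \<in> carrier_mat k k \<longleftrightarrow> k = n" for k
    by (auto simp: adjacency_matrix_def n_def)
  have vec: "(x \<noteq> 0\<^sub>v n \<and> 0\<^sub>v n \<le> x \<and> lam \<cdot>\<^sub>v x \<le> adjacency_matrix G vs *\<^sub>v x \<and>
              x \<bullet> (adjacency_matrix G vs *\<^sub>v x - lam \<cdot>\<^sub>v x) = 0) \<longleftrightarrow> ?R y"
    if x: "x \<in> carrier_vec n" and xy: "\<And>i. i < n \<Longrightarrow> x $ i = y (vs ! i)" for x y
  proof -
    have dim: "dim_vec x = n" using x by simp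
    have dimA: "dim_row (adjacency_matrix G vs) = n"
      by (simp add: adjacency_matrix_def n_def)
    have Ax: "(adjacency_matrix G vs *\<^sub>v x) $ i =
              (\<Sum>w\<in>verts G. if vs ! i \<rightarrow>\<^bsub>G\<^esub> w then y w else 0)" if "i < n" for i
    proof -
      have "(adjacency_matrix G vs *\<^sub>v x) $ i =
            (\<Sum>j = 0..<n. row (adjacency_matrix G vs) i $ j * x $ j)"
        using that dim dimA by (simp add: scalar_prod_def)
      also have "\<dots> = (\<Sum>j = 0..<n. if vs ! i \<rightarrow>\<^bsub>G\<^esub> vs ! j then y (vs ! j) else 0)"
        using that xy by (intro sum.cong refl) (simp add: adjacency_matrix_def n_def[symmetric])
      finally show ?thesis by (simp add: sum)
    qed
    define z where "z v = (\<Sum>w\<in>verts G. if v \<rightarrow>\<^bsub>G\<^esub> w then y w else 0)" for v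
    have Az: "(adjacency_matrix G vs *\<^sub>v x) $ i = z (vs ! i)" if "i < n" for i
      using Ax[OF that] by (simp only: z_def)
    have 1: "x \<noteq> 0\<^sub>v n \<longleftrightarrow> (\<exists>v\<in>verts G. y v \<noteq> 0)"
      unfolding bex using dim xy by (auto simp: vec_eq_iff)
    have 2: "0\<^sub>v n \<le> x \<longleftrightarrow> (\<forall>v\<in>verts G. 0 \<le> y v)"
      unfolding ball using dim xy by (auto simp: less_eq_vec_def)
    have 3: "lam \<cdot>\<^sub>v x \<le> adjacency_matrix G vs *\<^sub>v x \<longleftrightarrow> (\<forall>v\<in>verts G. lam * y v \<le> z v)"
      unfolding ball using dim dimA xy Az
      by (simp add: less_eq_vec_def del: index_mult_mat_vec)
    have 4: "x \<bullet> (adjacency_matrix G vs *\<^sub>v x - lam \<cdot>\<^sub>v x) = (\<Sum>v\<in>verts G. y v * (z v - lam * y v))"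
      unfolding sum[of "\<lambda>v. y v * (z v - lam * y v)"] using dim dimA xy Az
      by (simp add: scalar_prod_def del: index_mult_mat_vec)
    show ?thesis unfolding 1 2 3 4 z_def ..
  qed
  show ?thesis
  proof
    assume ?L
    then obtain x where x: "x \<in> carrier_vec n" "x \<noteq> 0\<^sub>v n \<and> 0\<^sub>v n \<le> x \<and>
        lam \<cdot>\<^sub>v x \<le> adjacency_matrix G vs *\<^sub>v x \<and>
        x \<bullet> (adjacency_matrix G vs *\<^sub>v x - lam \<cdot>\<^sub>v x) = 0"
      unfolding complementarity_eigenvalue_def carr by blast
    define y where "y v = x $ (the_inv_into {0..<n} ((!) vs) v)" for v
    have "x $ i = y (vs ! i)" if "i < n" for i
      using that bij by (simp add: y_def the_inv_into_f_f bij_betw_def)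
    from vec[OF x(1), of y, OF this] x(2) show "\<exists>y. ?R y" by blast
  next
    assume "\<exists>y. ?R y"
    then obtain y where y: "?R y" by blast
    define x where "x = vec n (\<lambda>i. y (vs ! i))"
    have x: "x \<in> carrier_vec n" by (simp add: x_def)
    have "x $ i = y (vs ! i)" if "i < n" for i
      using that by (simp add: x_def)
    from vec[OF x, of y, OF this] y have "x \<noteq> 0\<^sub>v n \<and> 0\<^sub>v n \<le> x \<and>
        lam \<cdot>\<^sub>v x \<le> adjacency_matrix G vs *\<^sub>v x \<and>
        x \<bullet> (adjacency_matrix G vs *\<^sub>v x - lam \<cdot>\<^sub>v x) = 0"
      by blast
    with x show ?L
      unfolding complementarity_eigenvalue_def carr by blast
  qed
qed

lemma complementarity_spectrum_labelling:
  assumes "distinct vs" "set vs = verts G"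
  shows "complementarity_spectrum G =
    {lam. complementarity_eigenvalue (adjacency_matrix G vs) lam}"
proof -
  have "complementarity_eigenvalue (adjacency_matrix G ws) lam \<longleftrightarrow>
        complementarity_eigenvalue (adjacency_matrix G vs) lam"
    if "distinct ws" "set ws = verts G" for ws lam
    unfolding complementarity_eigenvalue_adjacency_matrix[OF that]
      complementarity_eigenvalue_adjacency_matrix[OF assms] ..
  with assms show ?thesis
    unfolding complementarity_spectrum_def by blast
qed

end

theory Submission
  imports Defs Complex_Main
begin

text \<open>
  The idea is that a Type 2 digraph has exactly one complementarity eigenvalue above \<open>1\<close>, its
  spectral radius, and that this number together with the number of vertices already fixes the
  unordered pair of cycle lengths.

  Let \<open>x\<close> be a complementarity eigenvector of \<open>D2 r s\<close> for some \<open>\<lambda> > 1\<close>. On its support it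
  satisfies the ordinary eigenvector equations, and along each of the two directed paths
  \<open>2, \<dots>, r\<close> and \<open>r + 1, \<dots>, r + s - 1\<close> these say that the entries grow by the factor \<open>\<lambda>\<close>. So
  everything is governed by the three entries \<open>a\<close>, \<open>b\<close> at the starts of the paths and \<open>c\<close> at the
  vertex \<open>1\<close>, each of which, when nonzero, satisfies
  \<open>\<lambda> ^ (r - 1) * a = c + b\<close>, \<open>\<lambda> ^ (s - 1) * b = c + a\<close>, \<open>\<lambda> * c = a + b\<close>, respectively.
  Because \<open>\<lambda> > 1\<close>, a nonzero entry is smaller than the sum of the other two, so none of the three
  can vanish. Hence the whole \<open>3 \<times> 3\<close> system holds, and eliminating the unknowns leaves the
  characteristic equation
  \<open>\<lambda> ^ (r + s - 1) = \<lambda> ^ (r - 1) + \<lambda> ^ (s - 1) + \<lambda> + 2\<close>.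
  Conversely every solution \<open>\<lambda> > 1\<close> of it yields a positive eigenvector
  (\<open>complementarity_spectrum_D2_above_one\<close>), and the intermediate value theorem provides a solution
  (\<open>characteristic_root_exists\<close>).

  Two Type 2 digraphs with \<open>n\<close> vertices and equal spectra therefore share a root \<open>\<lambda> > 1\<close>. The
  equation then gives both pairs \<open>\<lambda> ^ (r - 1)\<close>, \<open>\<lambda> ^ (s - 1)\<close> the same sum, and they
  have the same product \<open>\<lambda> ^ (n - 1)\<close>. So the pairs of cycle lengths agree up to
  order (\<open>power_sum_determines_exponents\<close>), and exchanging the two cycles is an isomorphism
  (\<open>digraph_iso_D2_swap\<close>).
\<close>

section \<open>The complementarity spectrum of a digraph\<close>

text \<open>Relabelling along the isomorphism turns a labelling of one digraph into a labelling of the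
  other that has literally the same adjacency matrix.\<close>

lemma complementarity_spectrum_iso_subset:
  assumes "digraph_iso G H"
  shows "complementarity_spectrum G \<subseteq> complementarity_spectrum H"
proof
  fix lam assume "lam \<in> complementarity_spectrum G"
  then obtain vs where vs: "distinct vs" "set vs = verts G"
      and ev: "complementarity_eigenvalue (adjacency_matrix G vs) lam"
    by (auto simp: complementarity_spectrum_def)
  from assms obtain f where iso: "pre_digraph.digraph_isomorphism G f" and H: "H = app_iso f G"
    by (auto simp: digraph_iso_def)
  then interpret wf_digraph G by (simp add: pre_digraph.digraph_isomorphism_def)
  have inj: "inj_on (iso_verts f) (verts G)"
    by (rule digraph_isomorphism_inj_on_verts[OF iso])
  have arc: "iso_verts f u \<rightarrow>\<^bsub>H\<^esub> iso_verts f v \<longleftrightarrow> u \<rightarrow>\<^bsub>G\<^esub> v"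
    if "u \<in> verts G" "v \<in> verts G" for u v
    unfolding H arcs_ends_app_iso_eq[OF iso]
    using that inj by (auto dest: inj_onD adj_in_verts)
  have "adjacency_matrix H (map (iso_verts f) vs) = adjacency_matrix G vs"
    unfolding adjacency_matrix_def using vs(2) by (intro cong_mat) (auto simp: arc simp flip: vs(2))
  moreover have "distinct (map (iso_verts f) vs)"
    using vs inj by (simp add: distinct_map)
  moreover have "set (map (iso_verts f) vs) = verts H"
    using vs by (simp add: H)
  ultimately show "lam \<in> complementarity_spectrum H"
    using ev unfolding complementarity_spectrum_def by (metis (mono_tags, lifting) mem_Collect_eq)
qed

lemma complementarity_spectrum_iso:
  assumes "wf_digraph G" "digraph_iso G H"
  shows "complementarity_spectrum G = complementarity_spectrum H"
  using complementarity_spectrum_iso_subset[OF assms(2)]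
    complementarity_spectrum_iso_subset[OF digraph_iso_swap[OF assms]] by blast

lemma card_verts_iso:
  assumes "digraph_iso G H"
  shows "card (verts G) = card (verts H)"
  using assms
  by (auto simp: digraph_iso_def pre_digraph.digraph_isomorphism_def card_image)

text \<open>A complementarity eigenvector is described by the ordinary eigenvector equations on its
  support: complementarity says that a sum of nonnegative terms vanishes, and off the support
  the inequality only asks for a sum of nonnegative entries to be nonnegative.\<close>

lemma mem_complementarity_spectrum_iff:
  assumes "finite (verts G)"
  shows "lam \<in> complementarity_spectrum G \<longleftrightarrow>
    (\<exists>x. (\<exists>v\<in>verts G. x v \<noteq> 0) \<and> (\<forall>v\<in>verts G. 0 \<le> x v) \<and>
      (\<forall>v\<in>verts G. x v \<noteq> 0 \<longrightarrow> lam * x v = (\<Sum>w\<in>verts G. if v \<rightarrow>\<^bsub>G\<^esub> w then x w else 0)))"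
proof -
  from assms obtain vs where vs: "distinct vs" "set vs = verts G"
    using finite_distinct_list by metis
  have "((\<forall>v\<in>verts G. lam * x v \<le> z v) \<and> (\<Sum>v\<in>verts G. x v * (z v - lam * x v)) = 0) \<longleftrightarrow>
      (\<forall>v\<in>verts G. x v \<noteq> 0 \<longrightarrow> lam * x v = z v)"
    if nn: "\<forall>v\<in>verts G. 0 \<le> x v" and znn: "\<forall>v\<in>verts G. 0 \<le> z v" for x z :: "_ \<Rightarrow> real"
  proof
    assume A: "(\<forall>v\<in>verts G. lam * x v \<le> z v) \<and> (\<Sum>v\<in>verts G. x v * (z v - lam * x v)) = 0"
    have "\<forall>v\<in>verts G. 0 \<le> x v * (z v - lam * x v)" using A nn by simp
    with A have "\<forall>v\<in>verts G. x v * (z v - lam * x v) = 0"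
      using assms by (simp add: sum_nonneg_eq_0_iff)
    then show "\<forall>v\<in>verts G. x v \<noteq> 0 \<longrightarrow> lam * x v = z v" by auto
  next
    assume A: "\<forall>v\<in>verts G. x v \<noteq> 0 \<longrightarrow> lam * x v = z v"
    have "\<forall>v\<in>verts G. lam * x v \<le> z v"
      using A znn by (metis mult_zero_right order_refl)
    moreover have "(\<Sum>v\<in>verts G. x v * (z v - lam * x v)) = 0"
      using A by (intro sum.neutral) auto
    ultimately show "(\<forall>v\<in>verts G. lam * x v \<le> z v) \<and>
        (\<Sum>v\<in>verts G. x v * (z v - lam * x v)) = 0" by simp
  qed
  note support = this
  have nonneg: "\<forall>v\<in>verts G. 0 \<le> (\<Sum>w\<in>verts G. if v \<rightarrow>\<^bsub>G\<^esub> w then x w else 0)"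
    if "\<forall>v\<in>verts G. 0 \<le> x v" for x :: "_ \<Rightarrow> real"
    using that by (auto intro!: sum_nonneg)
  show ?thesis
    unfolding complementarity_spectrum_labelling[OF vs] mem_Collect_eq
      complementarity_eigenvalue_adjacency_matrix[OF vs]
    using support[OF _ nonneg] by (intro ex_cong1) blast
qed

section \<open>The arcs of a Type 2 digraph\<close>

text \<open>With the encoding of \<open>k'\<close> as \<open>r + k - 1\<close>, the digraph becomes the vertex \<open>1\<close>
  together with the two paths \<open>2, \<dots>, r\<close> and \<open>r + 1, \<dots>, r + s - 1\<close>: the vertex \<open>1\<close> leads to
  the start of both paths, and the end of each path leads to \<open>1\<close> and to the start of the other
  path. This is the form in which the symmetry between the two cycles is visible.\<close>

lemma arc_D2_iff:
  assumes "2 \<le> r" "2 \<le> s"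
  shows "(v, w) \<in> parcs (D2 r s) \<longleftrightarrow>
    (v = 1 \<and> (w = 2 \<or> w = r + 1)) \<or> (2 \<le> v \<and> v < r \<and> w = v + 1) \<or>
    (v = r \<and> (w = 1 \<or> w = r + 1)) \<or> (r + 1 \<le> v \<and> v < r + s - 1 \<and> w = v + 1) \<or>
    (v = r + s - 1 \<and> (w = 1 \<or> w = 2))"
proof -
  have cyc: "dicycle_arcs m = {(1, 2), (m, 1)} \<union> {(k, k + 1) | k. 2 \<le> k \<and> k < m}" if "2 \<le> m" for m
  proof -
    have "1 \<le> k \<and> k < m \<longleftrightarrow> k = 1 \<or> 2 \<le> k \<and> k < m" for k using that by auto
    then have "{(k, k + 1) | k. 1 \<le> k \<and> k < m} = {(1, 2)} \<union> {(k, k + 1) | k. 2 \<le> k \<and> k < m}"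
      by (auto simp: numeral_2_eq_2)
    then show ?thesis by (auto simp: dicycle_arcs_def)
  qed
  have img: "map_prod (primed r) (primed r) ` dicycle_arcs s =
      {(1, r + 1), (r + s - 1, 1)} \<union> {(k, k + 1) | k. r + 1 \<le> k \<and> k < r + s - 1}"
  proof -
    have "map_prod (primed r) (primed r) ` {(k, k + 1) | k. 2 \<le> k \<and> k < s} =
        {(k, k + 1) | k. r + 1 \<le> k \<and> k < r + s - 1}"
    proof (intro equalityI subsetI)
      fix e assume "e \<in> {(k, k + 1) | k. r + 1 \<le> k \<and> k < r + s - 1}"
      then obtain k where "e = (k, k + 1)" "r + 1 \<le> k" "k < r + s - 1" by auto
      then show "e \<in> map_prod (primed r) (primed r) ` {(k, k + 1) | k. 2 \<le> k \<and> k < s}"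
        by (intro image_eqI[of _ _ "(k + 1 - r, k + 1 - r + 1)"]) (auto simp: primed_def)
    qed (auto simp: primed_def)
    moreover have "map_prod (primed r) (primed r) ` {(1, 2), (s, 1)} = {(1, r + 1), (r + s - 1, 1)}"
      using assms by (auto simp: primed_def)
    ultimately show ?thesis by (simp only: cyc[OF assms(2)] image_Un)
  qed
  have "primed r 2 = r + 1" "primed r s = r + s - 1" using assms by (auto simp: primed_def)
  then show ?thesis
    by (simp add: D2_def infty_digraph_def img cyc[OF assms(1)]) auto
qed

lemma arcs_D2:
  assumes "2 \<le> r" "2 \<le> s"
  shows "(1, 2) \<in> parcs (D2 r s)" "(1, r + 1) \<in> parcs (D2 r s)"
    "(r, 1) \<in> parcs (D2 r s)" "(r, r + 1) \<in> parcs (D2 r s)"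
    "(r + s - 1, 1) \<in> parcs (D2 r s)" "(r + s - 1, 2) \<in> parcs (D2 r s)"
    "\<lbrakk>2 \<le> v; v < r\<rbrakk> \<Longrightarrow> (v, v + 1) \<in> parcs (D2 r s)"
    "\<lbrakk>r + 1 \<le> v; v < r + s - 1\<rbrakk> \<Longrightarrow> (v, v + 1) \<in> parcs (D2 r s)"
  by (simp_all add: arc_D2_iff[OF assms])

lemma out_neighbours_D2:
  assumes "2 \<le> r" "2 \<le> s" "v \<in> {1..r + s - 1}"
  shows "{w \<in> {1..r + s - 1}. (v, w) \<in> parcs (D2 r s)} =
    (if v = 1 then {2, r + 1} else if v = r then {1, r + 1}
     else if v = r + s - 1 then {1, 2} else {v + 1})"
  unfolding arc_D2_iff[OF assms(1,2)] using assms by auto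

lemma out_sum_D2:
  assumes "2 \<le> r" "2 \<le> s" "v \<in> {1..r + s - 1}"
  shows "(\<Sum>w\<in>{1..r + s - 1}. if (v, w) \<in> parcs (D2 r s) then x w else (0::real)) =
    (if v = 1 then x 2 + x (r + 1) else if v = r then x 1 + x (r + 1)
     else if v = r + s - 1 then x 1 + x 2 else x (v + 1))"
proof -
  have "(\<Sum>w\<in>{1..r + s - 1}. if (v, w) \<in> parcs (D2 r s) then x w else 0) =
      sum x {w \<in> {1..r + s - 1}. (v, w) \<in> parcs (D2 r s)}"
    by (rule sum.inter_filter[symmetric]) simp
  then show ?thesis unfolding out_neighbours_D2[OF assms] using assms by auto
qed

section \<open>The characteristic equation\<close>

text \<open>The three equations below are required only where the unknown on the left is nonzero;
  \<open>lam > 1\<close> makes each nonzero unknown smaller than the sum of the other two, which excludes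
  every proper support.\<close>

lemma characteristic_equation_of_reduced_system:
  fixes lam a b c :: real
  assumes "1 < lam" "0 < p" "0 < q" and nonneg: "0 \<le> a" "0 \<le> b" "0 \<le> c"
    and nz: "a \<noteq> 0 \<or> b \<noteq> 0 \<or> c \<noteq> 0"
    and a: "a \<noteq> 0 \<Longrightarrow> lam ^ p * a = c + b"
    and b: "b \<noteq> 0 \<Longrightarrow> lam ^ q * b = c + a"
    and c: "c \<noteq> 0 \<Longrightarrow> lam * c = a + b"
  shows "lam ^ (p + q + 1) = lam ^ p + lam ^ q + lam + 2"
proof -
  have gt: "y < t * y" if "0 \<le> y" "y \<noteq> 0" "1 < t" for y t :: real
    using that by (metis mult_1 mult_strict_right_mono order_le_less)
  have "1 < lam ^ p" "1 < lam ^ q" using assms by (auto intro: one_less_power)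
  then have "a \<noteq> 0 \<longrightarrow> a < c + b" "b \<noteq> 0 \<longrightarrow> b < c + a" "c \<noteq> 0 \<longrightarrow> c < a + b"
    using gt[of a "lam ^ p"] gt[of b "lam ^ q"] gt[of c lam] nonneg a b c \<open>1 < lam\<close> by auto
  then have pos: "0 < a" "0 < b" "0 < c" using nonneg nz by linarith+
  define P Q where "P = lam ^ p" and "Q = lam ^ q"
  have eqs: "P * a = c + b" "Q * b = c + a" "lam * c = a + b"
    using a b c pos by (auto simp: P_def Q_def)
  \<comment> \<open>Eliminating \<open>c\<close> and then multiplying the two remaining equations cancels \<open>a * b\<close>.\<close>
  have elim: "u * (lam * R - 1) = v * (lam + 1)" if "R * u = c + v" "lam * c = u + v" for u v R
  proof -
    have "u * (lam * R - 1) = lam * (R * u) - u" by (simp add: algebra_simps)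
    also have "\<dots> = lam * c + lam * v - u" by (simp only: that(1) distrib_left)
    also have "\<dots> = v * (lam + 1)" unfolding that(2) by (simp add: algebra_simps)
    finally show ?thesis .
  qed
  have "a * b * ((lam * P - 1) * (lam * Q - 1)) = (a * (lam * P - 1)) * (b * (lam * Q - 1))" by simp
  also have "\<dots> = (b * (lam + 1)) * (a * (lam + 1))"
    using elim[OF eqs(1,3)] elim[OF eqs(2)] eqs(3) by (simp add: add.commute)
  also have "\<dots> = a * b * (lam + 1)\<^sup>2" by (simp add: power2_eq_square)
  finally have "(lam * P - 1) * (lam * Q - 1) = (lam + 1)\<^sup>2" using pos by simp
  then have "lam * (lam * P * Q) = lam * (P + Q + lam + 2)"
    by (simp add: power2_eq_square algebra_simps)
  then have "lam * P * Q = P + Q + lam + 2" using \<open>1 < lam\<close> by simp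
  then show ?thesis by (simp add: P_def Q_def power_add algebra_simps)
qed

text \<open>The recursion is known only on the support of \<open>x\<close>, but it keeps a nonzero entry nonzero, so
  it carries on to the end of the path.\<close>

lemma geometric_while_nonzero:
  fixes x :: "nat \<Rightarrow> real"
  assumes step: "\<And>k. \<lbrakk>i \<le> k; k < j; x k \<noteq> 0\<rbrakk> \<Longrightarrow> x (k + 1) = lam * x k"
    and "lam \<noteq> 0" "x i \<noteq> 0" "i \<le> j"
  shows "x j = lam ^ (j - i) * x i"
  using \<open>i \<le> j\<close> step
proof (induction j rule: dec_induct)
  case (step n)
  then have "x n = lam ^ (n - i) * x i" by simp
  moreover from this have "x n \<noteq> 0" using assms by simp
  ultimately show ?case using step by (simp add: Suc_diff_le)
qed simp

text \<open>The bound \<open>1 < lam\<close> singles out the eigenvalues with full support: each directed cycle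
  inside the digraph contributes the value \<open>1\<close>, which says nothing about \<open>r\<close> and \<open>s\<close>.\<close>

lemma complementarity_spectrum_D2_above_one:
  assumes rs: "2 \<le> r" "2 \<le> s" and lam: "1 < lam"
  shows "lam \<in> complementarity_spectrum (with_proj (D2 r s)) \<longleftrightarrow>
    lam ^ (r + s - 1) = lam ^ (r - 1) + lam ^ (s - 1) + lam + 2"
    (is "?L \<longleftrightarrow> ?R")
proof -
  define S where "S x v = (if v = 1 then x 2 + x (r + 1) else if v = r then x 1 + x (r + 1)
     else if v = r + s - 1 then x 1 + x 2 else x (v + 1))" for x :: "nat \<Rightarrow> real" and v
  have S_inner: "S x v = x (v + 1)" if "v \<noteq> 1" "v \<noteq> r" "v \<noteq> r + s - 1" for v x
    unfolding S_def using that by (simp only: if_False)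
  have spectrum: "?L \<longleftrightarrow> (\<exists>x. (\<exists>v\<in>{1..r + s - 1}. x v \<noteq> 0) \<and> (\<forall>v\<in>{1..r + s - 1}. 0 \<le> x v) \<and>
      (\<forall>v\<in>{1..r + s - 1}. x v \<noteq> 0 \<longrightarrow> lam * x v = S x v))"
    using out_sum_D2[OF rs]
    by (subst mem_complementarity_spectrum_iff) (simp_all add: pverts_D2[OF rs] S_def)
  have expo: "r + s - 1 = (r - 1) + (s - 1) + 1" using rs by simp
  have pow: "lam ^ (m - 1) = lam * lam ^ (m - 2)" if "2 \<le> m" for m
  proof -
    have "m - 1 = Suc (m - 2)" using that by simp
    then show ?thesis by (simp only: power_Suc)
  qed
  show ?thesis
  proof
    assume ?L
    then obtain x where nz: "\<exists>v\<in>{1..r + s - 1}. x v \<noteq> 0" and nonneg: "\<forall>v\<in>{1..r + s - 1}. 0 \<le> x v"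
      and eq: "\<forall>v\<in>{1..r + s - 1}. x v \<noteq> 0 \<longrightarrow> lam * x v = S x v"
      using spectrum by blast
    have step: "x (k + 1) = lam * x k"
      if "1 < k" "k \<noteq> r" "k < r + s - 1" "x k \<noteq> 0" for k
      using that eq S_inner[of k x] by simp
    have first: "x r = lam ^ (r - k) * x k" if "2 \<le> k" "k \<le> r" "x k \<noteq> 0" for k
      by (rule geometric_while_nonzero) (use that lam rs step in auto)
    have second: "x (r + s - 1) = lam ^ (r + s - 1 - k) * x k"
      if "r + 1 \<le> k" "k \<le> r + s - 1" "x k \<noteq> 0" for k
      by (rule geometric_while_nonzero) (use that lam rs step in auto)
    have end_first: "lam * x r = x 1 + x (r + 1)" if "x r \<noteq> 0"
      using that eq rs by (auto simp: S_def)
    have end_second: "lam * x (r + s - 1) = x 1 + x 2" if "x (r + s - 1) \<noteq> 0"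
      using that eq rs by (auto simp: S_def)
    have "0 \<le> x 2" "0 \<le> x (r + 1)" "0 \<le> x 1" using nonneg rs by auto
    moreover have "x 2 \<noteq> 0 \<or> x (r + 1) \<noteq> 0 \<or> x 1 \<noteq> 0"
    proof -
      from nz obtain v where v: "v \<in> {1..r + s - 1}" "x v \<noteq> 0" by blast
      have "v = 1 \<or> 2 \<le> v \<and> v \<le> r \<or> r + 1 \<le> v \<and> v \<le> r + s - 1"
        using v(1) unfolding atLeastAtMost_iff by linarith
      then consider "v = 1" | "2 \<le> v" "v \<le> r" | "r + 1 \<le> v" "v \<le> r + s - 1"
        by blast
      then show ?thesis
      proof cases
        case 2
        then have "x r \<noteq> 0" using first[of v] v lam by simp
        then show ?thesis using end_first lam by auto
      next
        case 3
        then have "x (r + s - 1) \<noteq> 0" using second[of v] v lam by simp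
        then show ?thesis using end_second lam by auto
      qed (use v in simp)
    qed
    moreover have "lam ^ (r - 1) * x 2 = x 1 + x (r + 1)" if "x 2 \<noteq> 0"
    proof -
      have "x r = lam ^ (r - 2) * x 2" by (rule first) (use that rs in auto)
      moreover from this have "lam * x r = x 1 + x (r + 1)" using end_first lam that by auto
      moreover have "lam ^ (r - 1) = lam * lam ^ (r - 2)" by (rule pow[OF rs(1)])
      ultimately show ?thesis by (metis mult.assoc)
    qed
    moreover have "lam ^ (s - 1) * x (r + 1) = x 1 + x 2" if "x (r + 1) \<noteq> 0"
    proof -
      have "x (r + s - 1) = lam ^ (r + s - 1 - (r + 1)) * x (r + 1)"
        by (rule second) (use that rs in auto)
      moreover have "r + s - 1 - (r + 1) = s - 2" using rs by simp
      ultimately have "x (r + s - 1) = lam ^ (s - 2) * x (r + 1)" by (simp only:)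
      moreover from this have "lam * x (r + s - 1) = x 1 + x 2" using end_second lam that by auto
      moreover have "lam ^ (s - 1) = lam * lam ^ (s - 2)" by (rule pow[OF rs(2)])
      ultimately show ?thesis by (metis mult.assoc)
    qed
    moreover have "lam * x 1 = x 2 + x (r + 1)" if "x 1 \<noteq> 0"
      using that eq rs by (auto simp: S_def)
    moreover have "0 < r - 1" "0 < s - 1" using rs by simp_all
    ultimately have "lam ^ ((r - 1) + (s - 1) + 1) = lam ^ (r - 1) + lam ^ (s - 1) + lam + 2"
      using characteristic_equation_of_reduced_system
        [of lam "r - 1" "s - 1" "x 2" "x (r + 1)" "x 1", OF lam] by blast
    then show ?R by (simp only: expo)
  next
    assume R: ?R
    define P Q where "P = lam ^ (r - 1)" and "Q = lam ^ (s - 1)"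
    have PQ: "lam * P * Q = P + Q + lam + 2"
      using R unfolding P_def Q_def expo by (simp add: power_add algebra_simps)
    have gt: "1 < P" using rs lam by (auto simp: P_def intro: one_less_power)
    \<comment> \<open>A nonzero solution of the reduced system: with \<open>c\<close> eliminated its first equation reads
      \<open>a * (lam * P - 1) = b * (lam + 1)\<close>.\<close>
    define a b c where "a = lam + 1" and "b = lam * P - 1" and "c = (a + b) / lam"
    have "1 < lam * P" by (rule less_1_mult[OF lam gt])
    then have pos: "0 < a" "0 < b" using lam by (auto simp: a_def b_def)
    then have cpos: "0 < c" using lam by (simp add: c_def)
    have c: "lam * c = a + b" using lam by (simp add: c_def)
    have "lam * (P * a) = lam * (c + b)" using c by (simp add: a_def b_def algebra_simps)
    then have first: "P * a = c + b" using lam by simp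
    have "lam * (Q * b) = lam * (lam * P * Q) - lam * Q" by (simp add: b_def algebra_simps)
    also have "\<dots> = lam * (P + Q + lam + 2) - lam * Q" by (simp only: PQ)
    also have "\<dots> = (a + b) + lam * a" by (simp add: a_def b_def algebra_simps)
    also have "\<dots> = lam * (c + a)" using c by (simp add: distrib_left)
    finally have second: "Q * b = c + a" using lam by simp
    define x where "x v = (if v = 1 then c else if v \<le> r then lam ^ (v - 2) * a
      else lam ^ (v - (r + 1)) * b)" for v
    have xpos: "0 < x v" for v using pos cpos lam by (simp add: x_def)
    have Plam: "P = lam * lam ^ (r - 2)" and Qlam: "Q = lam * lam ^ (s - 2)"
      unfolding P_def Q_def using pow rs by blast+
    have at: "x 1 = c" "x 2 = a" "x (r + 1) = b" using rs by (auto simp: x_def)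
    have "lam * x v = S x v" if v: "v \<in> {1..r + s - 1}" for v
    proof -
      have "v = 1 \<or> v = r \<or> v = r + s - 1 \<or> 2 \<le> v \<and> v < r \<or> r + 1 \<le> v \<and> v < r + s - 1"
        using v unfolding atLeastAtMost_iff by linarith
      then consider "v = 1" | "v = r" | "v = r + s - 1" | "2 \<le> v" "v < r"
          | "r + 1 \<le> v" "v < r + s - 1"
        by blast
      then show ?thesis
      proof cases
        case 1
        then show ?thesis using c at by (simp add: S_def)
      next
        case 2
        then have "lam * x v = P * a" using rs by (simp add: x_def Plam)
        then show ?thesis using first 2 at rs by (simp add: S_def)
      next
        case 3
        have v': "\<not> v \<le> r" "v \<noteq> 1" "v \<noteq> r" "v - (r + 1) = s - 2" using rs 3 by simp_all
        then have "lam * x v = Q * b" by (simp add: x_def Qlam)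
        moreover have "S x v = x 1 + x 2" unfolding S_def 3[symmetric] using v' by simp
        ultimately show ?thesis using second at by simp
      next
        case 4
        have "x (v + 1) = lam ^ (v + 1 - 2) * a" unfolding x_def using 4 by simp
        also have "v + 1 - 2 = v - 1" by simp
        also have "lam ^ (v - 1) * a = lam * x v" unfolding x_def using 4 pow[of v] by simp
        finally have "x (v + 1) = lam * x v" .
        moreover have "v \<noteq> 1" "v \<noteq> r" "v \<noteq> r + s - 1" using 4 rs by linarith+
        then have "S x v = x (v + 1)" by (rule S_inner)
        ultimately show ?thesis by (simp only:)
      next
        case 5
        have "x (v + 1) = lam ^ (v + 1 - (r + 1)) * b" unfolding x_def using 5 rs by simp
        also have "v + 1 - (r + 1) = Suc (v - (r + 1))" using 5 by simp
        also have "lam ^ Suc (v - (r + 1)) * b = lam * x v" unfolding x_def using 5 rs by simp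
        finally have "x (v + 1) = lam * x v" .
        moreover have "v \<noteq> 1" "v \<noteq> r" "v \<noteq> r + s - 1" using 5 rs by linarith+
        then have "S x v = x (v + 1)" by (rule S_inner)
        ultimately show ?thesis by (simp only:)
      qed
    qed
    moreover have "\<exists>v\<in>{1..r + s - 1}. x v \<noteq> 0"
    proof
      show "1 \<in> {1..r + s - 1}" using rs by simp
      show "x 1 \<noteq> 0" using xpos[of 1] by (rule less_imp_neq[symmetric])
    qed
    ultimately show ?L unfolding spectrum using less_imp_le[OF xpos] by blast
  qed
qed

lemma characteristic_root_exists:
  assumes "0 < p" "0 < q"
  shows "\<exists>lam > 1. (lam::real) ^ (p + q + 1) = lam ^ p + lam ^ q + lam + 2"
proof -
  define f where "f t = t ^ (p + q + 1) - t ^ p - t ^ q - t - 2" for t :: real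
  have "(3::real) ^ 1 \<le> 3 ^ p" "(3::real) ^ 1 \<le> 3 ^ q"
    using assms by (intro power_increasing; simp)+
  then have ge: "3 \<le> (3::real) ^ p" "3 \<le> (3::real) ^ q" by simp_all
  have "0 \<le> (3 ^ p - 3) * ((3::real) ^ q - 3)" using ge by simp
  moreover have "(3::real) ^ (p + q + 1) = 3 * (3 ^ p * 3 ^ q)" by (simp add: power_add)
  ultimately have "0 \<le> f 3" using ge by (simp add: f_def algebra_simps)
  moreover have f1: "f 1 < 0" by (simp add: f_def)
  moreover have "\<forall>t. 1 \<le> t \<and> t \<le> 3 \<longrightarrow> isCont f t" unfolding f_def by (intro allI impI continuous_intros)
  ultimately obtain t where "1 \<le> t" "f t = 0" using IVT[of f 1 0 3] by auto
  moreover from this f1 have "t \<noteq> 1" by auto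
  ultimately show ?thesis by (intro exI[of _ t]) (auto simp: f_def)
qed

text \<open>Powers with exponents \<open>p\<close>, \<open>q\<close> have a product that depends only on \<open>p + q\<close>, so their sum
  determines the quadratic polynomial with these two roots.\<close>

lemma power_sum_determines_exponents:
  fixes lam :: real
  assumes "1 < lam" and exps: "p + q = p' + q'" and sums: "lam ^ p + lam ^ q = lam ^ p' + lam ^ q'"
  shows "p = p' \<and> q = q' \<or> p = q' \<and> q = p'"
proof -
  have "lam ^ p * lam ^ q = lam ^ p' * lam ^ q'" using exps by (simp flip: power_add)
  moreover have "lam ^ q = lam ^ p' + lam ^ q' - lam ^ p" using sums by simp
  ultimately have "(lam ^ p - lam ^ p') * (lam ^ p - lam ^ q') = 0" by (simp add: algebra_simps)
  then have "p = p' \<or> p = q'" using \<open>1 < lam\<close> by simp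
  then show ?thesis using exps by auto
qed

section \<open>Exchanging the two cycles\<close>

lemma digraph_iso_with_projI:
  assumes wf: "wf_digraph (with_proj G)" and inj: "inj_on f (pverts G)"
    and "pverts H = f ` pverts G" "parcs H = map_prod f f ` parcs G"
  shows "digraph_iso (with_proj G) (with_proj H)"
proof -
  define h where "h = \<lparr>iso_verts = f, iso_arcs = map_prod f f, iso_head = snd, iso_tail = fst\<rparr>"
  interpret wf_digraph "with_proj G" by (rule wf)
  have "parcs G \<subseteq> pverts G \<times> pverts G" using head_in_verts tail_in_verts by force
  then have "inj_on (map_prod f f) (parcs G)"
    using map_prod_inj_on[OF inj inj] inj_on_subset by blast
  then have "digraph_isomorphism h"
    using wf inj by (simp add: digraph_isomorphism_def h_def)
  moreover have "with_proj H = app_iso h (with_proj G)"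
    using assms by (simp add: app_iso_def h_def with_proj_def)
  ultimately show ?thesis by (auto simp: digraph_iso_def)
qed

lemma wf_digraph_D2:
  assumes "2 \<le> r" "2 \<le> s"
  shows "wf_digraph (with_proj (D2 r s))"
  using pair_digraph_D2[OF assms] unfolding wf_digraph_wp_iff
  by (simp add: pair_digraph_def pair_fin_digraph_def)

lemma digraph_iso_D2_swap:
  assumes rs: "2 \<le> r" "2 \<le> s"
  shows "digraph_iso (with_proj (D2 r s)) (with_proj (D2 s r))"
proof -
  \<comment> \<open>The vertex \<open>1\<close> stays, and the two paths change places in the linear numbering.\<close>
  define sw :: "nat \<Rightarrow> nat \<Rightarrow> nat \<Rightarrow> nat"
    where "sw m l v = (if v = 1 then 1 else if v \<le> m then v + l - 1 else v - m + 1)" for m l v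
  have inv: "sw l m (sw m l v) = v" if "2 \<le> m" "2 \<le> l" "v \<in> {1..m + l - 1}" for m l v
    using that by (auto simp: sw_def)
  have range: "sw m l v \<in> {1..l + m - 1}" if "2 \<le> m" "2 \<le> l" "v \<in> {1..m + l - 1}" for m l v
    using that by (auto simp: sw_def)
  have arc: "(sw m l v, sw m l w) \<in> parcs (D2 l m)"
    if ml: "2 \<le> m" "2 \<le> l" and vw: "(v, w) \<in> parcs (D2 m l)" for m l v w
  proof -
    let ?v = "sw m l v" and ?w = "sw m l w"
    from vw consider (a) "v = 1" "w = 2" | (b) "v = 1" "w = m + 1"
      | (c) "2 \<le> v" "v < m" "w = v + 1" | (d) "v = m" "w = 1" | (e) "v = m" "w = m + 1"
      | (f) "m + 1 \<le> v" "v < m + l - 1" "w = v + 1"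
      | (g) "v = m + l - 1" "w = 1" | (h) "v = m + l - 1" "w = 2"
      unfolding arc_D2_iff[OF ml] by blast
    then show ?thesis
    proof cases
      case a
      then have "?v = 1" "?w = l + 1" using ml by (simp_all add: sw_def)
      then show ?thesis by (simp only: arcs_D2[OF ml(2,1)])
    next
      case b
      then have "?v = 1" "?w = 2" using ml by (simp_all add: sw_def)
      then show ?thesis by (simp only: arcs_D2[OF ml(2,1)])
    next
      case c
      then have "l + 1 \<le> ?v" "?v < l + m - 1" "?w = ?v + 1"
        using ml by (simp_all add: sw_def)
      then show ?thesis by (simp only: arcs_D2[OF ml(2,1)])
    next
      case d
      then have "?v = l + m - 1" "?w = 1" using ml by (simp_all add: sw_def)
      then show ?thesis by (simp only: arcs_D2[OF ml(2,1)])
    next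
      case e
      then have "?v = l + m - 1" "?w = 2" using ml by (simp_all add: sw_def)
      then show ?thesis by (simp only: arcs_D2[OF ml(2,1)])
    next
      case f
      then have "2 \<le> ?v" "?v < l" "?w = ?v + 1" using ml by (simp_all add: sw_def)
      then show ?thesis by (simp only: arcs_D2[OF ml(2,1)])
    next
      case g
      then have "?v = l" "?w = 1" using ml by (simp_all add: sw_def)
      then show ?thesis by (simp only: arcs_D2[OF ml(2,1)])
    next
      case h
      then have "?v = l" "?w = l + 1" using ml by (simp_all add: sw_def)
      then show ?thesis by (simp only: arcs_D2[OF ml(2,1)])
    qed
  qed
  have ends: "v \<in> {1..m + l - 1}" "w \<in> {1..m + l - 1}"
    if "2 \<le> m" "2 \<le> l" "(v, w) \<in> parcs (D2 m l)" for m l v w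
    using that(3) unfolding arc_D2_iff[OF that(1,2)] using that(1,2) by auto
  have verts: "pverts (D2 s r) = sw r s ` pverts (D2 r s)"
    unfolding pverts_D2[OF rs] pverts_D2[OF rs(2,1)]
  proof (intro equalityI subsetI)
    fix v assume v: "v \<in> {1..s + r - 1}"
    show "v \<in> sw r s ` {1..r + s - 1}"
      using inv[OF rs(2,1) v] range[OF rs(2,1) v] by (metis image_eqI)
  qed (use range[OF rs] in blast)
  have arcs: "parcs (D2 s r) = map_prod (sw r s) (sw r s) ` parcs (D2 r s)"
  proof (intro equalityI subsetI)
    fix e assume e: "e \<in> parcs (D2 s r)"
    obtain v w where vw: "e = (v, w)" by force
    show "e \<in> map_prod (sw r s) (sw r s) ` parcs (D2 r s)"
      using arc[OF rs(2,1)] inv[OF rs(2,1)] ends[OF rs(2,1)] e unfolding vw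
      by (intro image_eqI[of _ _ "(sw s r v, sw s r w)"]) auto
  qed (use arc[OF rs] in auto)
  have "inj_on (sw r s) (pverts (D2 r s))"
    unfolding pverts_D2[OF rs] by (rule inj_on_inverseI) (rule inv[OF rs])
  from digraph_iso_with_projI[OF wf_digraph_D2[OF rs] this verts arcs] show ?thesis .
qed

section \<open>Type 2 digraphs are determined by their complementarity spectrum\<close>

theorem corollary3p10:
  fixes D :: "('a, 'b) pre_digraph" and H :: "('c, 'd) pre_digraph" and n :: nat
  assumes "type2_digraph D" and "type2_digraph H"
    and "card (verts D) = n" and "card (verts H) = n"
    and "complementarity_spectrum D = complementarity_spectrum H"
  shows "digraph_iso D H"
proof -
  obtain r s where rs: "2 \<le> r" "2 \<le> s" and D: "digraph_iso (with_proj (D2 r s)) D"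
    using assms(1) by (auto simp: type2_digraph_def)
  obtain r' s' where rs': "2 \<le> r'" "2 \<le> s'" and H: "digraph_iso (with_proj (D2 r' s')) H"
    using assms(2) by (auto simp: type2_digraph_def)
  have "r + s - 1 = n" "r' + s' - 1 = n"
    using card_verts_iso[OF D] card_verts_iso[OF H] assms(3,4) card_D2[OF rs] card_D2[OF rs'] by simp_all
  then have sum: "r + s - 1 = r' + s' - 1" by simp
  have spec: "complementarity_spectrum (with_proj (D2 r s)) = complementarity_spectrum (with_proj (D2 r' s'))"
    using complementarity_spectrum_iso[OF wf_digraph_D2[OF rs] D]
      complementarity_spectrum_iso[OF wf_digraph_D2[OF rs'] H] assms(5) by simp
  obtain lam :: real where lam: "1 < lam"
    and root: "lam ^ ((r - 1) + (s - 1) + 1) = lam ^ (r - 1) + lam ^ (s - 1) + lam + 2"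
    using characteristic_root_exists[of "r - 1" "s - 1"] rs by auto
  have "(r - 1) + (s - 1) + 1 = r + s - 1" using rs by simp
  then have root: "lam ^ (r + s - 1) = lam ^ (r - 1) + lam ^ (s - 1) + lam + 2"
    using root by (simp only:)
  then have "lam ^ (r' + s' - 1) = lam ^ (r' - 1) + lam ^ (s' - 1) + lam + 2"
    using complementarity_spectrum_D2_above_one[OF rs lam]
      complementarity_spectrum_D2_above_one[OF rs' lam] spec by simp
  then have "lam ^ (r - 1) + lam ^ (s - 1) = lam ^ (r' - 1) + lam ^ (s' - 1)"
    using root sum by simp
  moreover have "(r - 1) + (s - 1) = (r' - 1) + (s' - 1)"
  proof -
    have "(r - 1) + (s - 1) = r + s - 1 - 1" "(r' - 1) + (s' - 1) = r' + s' - 1 - 1"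
      using rs rs' by simp_all
    then show ?thesis by (simp only: sum)
  qed
  ultimately have "r - 1 = r' - 1 \<and> s - 1 = s' - 1 \<or> r - 1 = s' - 1 \<and> s - 1 = r' - 1"
    by (intro power_sum_determines_exponents[OF lam])
  moreover have "i = j" if "i - 1 = j - 1" "2 \<le> i" "2 \<le> j" for i j :: nat
    using that by simp
  ultimately have "r = r' \<and> s = s' \<or> r = s' \<and> s = r'"
    using rs rs' by blast
  then have "digraph_iso (with_proj (D2 r s)) H"
  proof
    assume "r = s' \<and> s = r'"
    with digraph_iso_D2_swap[OF rs] have "digraph_iso (with_proj (D2 r s)) (with_proj (D2 r' s'))"
      by simp
    then show ?thesis using H by (rule digraph_iso_trans)
  qed (use H in simp)
  then show ?thesis
    using digraph_iso_trans[OF digraph_iso_swap[OF wf_digraph_D2[OF rs] D]] by blast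
qed

end
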